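(* Let $m,n$ be positive integers. If $G\in\overline G_{m,n}$, then $diam(G)\le 4$.
   Context: All graphs are finite and simple. For positive integers $m,n$, $G_{m,n}$ denotes the class of all simple graphs that have the same degree sequence as the disjoint union $K_m\cup K_n$ of two cliques but are not isomorphic to $K_m\cup K_n$. $\overline G_{m,n}$ denotes the class of complements of graphs in $G_{m,n}$; equivalently, the graphs on $m+n$ vertices with $n$ vertices of degree $m$ and $m$ further vertices of degree $n$ that are not isomorphic to the complete bipartite graph $K_{m,n}$. The diameter $diam(G)$ is the maximum over all pairs of vertices $u,v$ of the distance $d(u,v)$, the number of edges in a shortest path between $u$ and $v$. *)

theory Defs
  imports "Graph_Theory.Graph_Theory" "HOL-Library.Multiset" "HOL-Library.Extended_Real"
begin

text \<open>
  A finite simple graph is a \<^locale>\<open>pair_graph\<close>, i.e. a finite, loop-free, symmetric digraph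
  without parallel arcs. Each undirected edge is the pair of arcs \<open>(u, v)\<close>, \<open>(v, u)\<close>, so the degree
  of a vertex is its \<^const>\<open>out_degree\<close>.
\<close>

definition complete_graph :: "nat \<Rightarrow> nat pair_pre_digraph" where
  "complete_graph n = \<lparr> pverts = {..<n}, parcs = {(u, v). u < n \<and> v < n \<and> u \<noteq> v} \<rparr>"

definition disjoint_union ::
    "'a pair_pre_digraph \<Rightarrow> 'b pair_pre_digraph \<Rightarrow> ('a + 'b) pair_pre_digraph" where
  "disjoint_union G H = \<lparr> pverts = pverts G <+> pverts H,
     parcs = map_prod Inl Inl ` parcs G \<union> map_prod Inr Inr ` parcs H \<rparr>"

definition graph_complement :: "'a pair_pre_digraph \<Rightarrow> 'a pair_pre_digraph" where
  "graph_complement G = \<lparr> pverts = pverts G,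
     parcs = {(u, v). u \<in> pverts G \<and> v \<in> pverts G \<and> u \<noteq> v \<and> (u, v) \<notin> parcs G} \<rparr>"

text \<open>The degree sequence, as an unordered family with multiplicities.\<close>

definition degree_sequence :: "('a, 'b) pre_digraph \<Rightarrow> nat multiset" where
  "degree_sequence G = image_mset (out_degree G) (mset_set (verts G))"

definition clique_pair_class :: "nat \<Rightarrow> nat \<Rightarrow> 'a pair_pre_digraph set" where
  "clique_pair_class m n = {G. pair_graph G
     \<and> degree_sequence (with_proj G)
         = degree_sequence (with_proj (disjoint_union (complete_graph m) (complete_graph n)))
     \<and> \<not> digraph_iso (with_proj G)
           (with_proj (disjoint_union (complete_graph m) (complete_graph n)))}"

definition co_clique_pair_class :: "nat \<Rightarrow> nat \<Rightarrow> 'a pair_pre_digraph set" where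
  "co_clique_pair_class m n = graph_complement ` clique_pair_class m n"

text \<open>
  With unit weights, \<^const>\<open>wf_digraph.\<mu>\<close> is the least number of edges of a walk from \<open>u\<close> to \<open>v\<close>,
  which is \<open>\<infinity>\<close> if there is none. Hence a disconnected graph has diameter \<open>\<infinity>\<close>, and a finite bound
  on the diameter includes connectedness.
\<close>

definition graph_dist :: "('a, 'b) pre_digraph \<Rightarrow> 'a \<Rightarrow> 'a \<Rightarrow> ereal" where
  "graph_dist G u v = wf_digraph.\<mu> G (\<lambda>_. 1) u v"

definition diameter :: "('a, 'b) pre_digraph \<Rightarrow> ereal" where
  "diameter G = (SUP u\<in>verts G. SUP v\<in>verts G. graph_dist G u v)"

lemma complete_graph_complete: "K\<^bsub>n\<^esub> (with_proj (complete_graph n))"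
  by (auto simp: complete_digraph_pair_def complete_graph_def)

lemma pair_graph_disjoint_union:
  assumes "pair_graph G" "pair_graph H"
  shows "pair_graph (disjoint_union G H)"
proof -
  interpret G: pair_graph G by fact
  interpret H: pair_graph H by fact
  have sG: "sym (parcs G)" and sH: "sym (parcs H)"
    using G.sym_arcs H.sym_arcs by (simp_all add: symmetric_def)
  show ?thesis
  proof
    show "symmetric (with_proj (disjoint_union G H))"
      using sG sH by (fastforce simp: symmetric_def disjoint_union_def sym_def)
  qed (auto simp: disjoint_union_def dest: G.wellformed' H.wellformed' G.pair_no_loops H.pair_no_loops)
qed

lemma pair_graph_complement:
  assumes "pair_graph G"
  shows "pair_graph (graph_complement G)"
proof -
  interpret G: pair_graph G by fact
  have sG: "sym (parcs G)"
    using G.sym_arcs by (simp add: symmetric_def)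
  show ?thesis
  proof
    show "symmetric (with_proj (graph_complement G))"
      using sG by (auto simp: symmetric_def graph_complement_def sym_def)
    show "finite (parcs (graph_complement G))"
      by (rule finite_subset[of _ "pverts G \<times> pverts G"]) (auto simp: graph_complement_def)
  qed (auto simp: graph_complement_def)
qed

lemma graph_complement_complement:
  assumes "pair_graph G"
  shows "graph_complement (graph_complement G) = G"
proof -
  interpret G: pair_graph G by fact
  show ?thesis
    by (rule pair_pre_digraph.equality)
      (auto simp: graph_complement_def dest: G.wellformed' G.pair_no_loops)
qed

lemma (in wf_digraph) graph_dist_eq_length_path:
  "graph_dist G u v = (INF p\<in>{p. apath u p v}. ereal (real (length p)))"
proof -
  have cost: "awalk_cost (\<lambda>_. 1) p = real (length p)" for p
    by (induct p) auto
  have "graph_dist G u v = (INF p\<in>{p. awalk u p v}. ereal (real (length p)))"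
    by (simp add: graph_dist_def \<mu>_def cost)
  also have "\<dots> = (INF p\<in>{p. apath u p v}. ereal (real (length p)))"
  proof (rule antisym)
    show "(INF p\<in>{p. awalk u p v}. ereal (real (length p)))
        \<le> (INF p\<in>{p. apath u p v}. ereal (real (length p)))"
      by (rule INF_superset_mono) (auto intro: awalkI_apath)
    show "(INF p\<in>{p. apath u p v}. ereal (real (length p)))
        \<le> (INF p\<in>{p. awalk u p v}. ereal (real (length p)))"
    proof (rule INF_mono)
      fix p assume "p \<in> {p. awalk u p v}"
      then have q: "apath u (awalk_to_apath p) v" and sub: "set (awalk_to_apath p) \<subseteq> set p"
        by (auto intro: apath_awalk_to_apath dest: awalk_to_apath_subset)
      have "distinct (awalk_to_apath p)"
        using q distinct_verts_imp_distinct by (auto simp: apath_def)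
      then have "length (awalk_to_apath p) \<le> length p"
        using sub by (metis card_length card_mono distinct_card finite_set le_trans)
      with q show "\<exists>q\<in>{p. apath u p v}. ereal (real (length q)) \<le> ereal (real (length p))"
        by auto
    qed
  qed
  finally show ?thesis .
qed

end

theory Submission
  imports Defs
begin

text \<open>
  The statement reduces to a counting argument around one vertex. In a member of
  \<open>co_clique_pair_class m n\<close> there are \<open>m + n\<close> vertices, every degree is \<open>m\<close> or \<open>n\<close>, and both
  values occur. Let \<open>y\<close> be a vertex of degree \<open>max m n\<close>. For every vertex \<open>u\<close> the closed
  neighbourhoods of \<open>y\<close> and \<open>u\<close> have together at least
  \<open>(max m n + 1) + (min m n + 1) = m + n + 2\<close> elements, more than there are vertices, so they
  meet and \<open>u\<close> is within distance \<open>2\<close> of \<open>y\<close>. Going through \<open>y\<close> connects any two vertices by a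
  walk of length at most \<open>4\<close>. The counting step is \<open>short_walk_if_large_degree_sum\<close>, and the
  passage through \<open>y\<close> is \<open>diameter_le_4_if_hub\<close>.
\<close>

context pair_graph
begin

lemma out_degree_eq_card_neighbours:
  "out_degree (with_proj G) v = card {w. (v, w) \<in> parcs G}"
proof -
  have "out_arcs (with_proj G) v = Pair v ` {w. (v, w) \<in> parcs G}"
    by (auto simp: out_arcs_def)
  then show ?thesis
    by (simp add: out_degree_def card_image inj_on_def)
qed

lemma arc_sym: "(u, v) \<in> parcs G \<Longrightarrow> (v, u) \<in> parcs G"
  using sym_arcs by (auto simp: symmetric_def dest: symD)

lemma card_closed_neighbourhood:
  "card (insert v {w. (v, w) \<in> parcs G}) = Suc (out_degree (with_proj G) v)"
proof -
  have "finite {w. (v, w) \<in> parcs G}"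
    by (rule finite_subset[of _ "pverts G"]) (auto dest: wellformed')
  moreover have "v \<notin> {w. (v, w) \<in> parcs G}"
    by (auto dest: pair_no_loops)
  ultimately show ?thesis
    unfolding out_degree_eq_card_neighbours by (rule card_insert_disjoint)
qed

text \<open>
  Two closed neighbourhoods with more elements in total than the graph has vertices share a
  vertex \<open>w\<close>, and \<open>w\<close> is equal or adjacent to each of the two centres.
\<close>

lemma short_walk_if_large_degree_sum:
  assumes "u \<in> pverts G" "v \<in> pverts G"
    and deg: "card (pverts G) \<le> Suc (out_degree (with_proj G) u + out_degree (with_proj G) v)"
  shows "\<exists>p. awalk u p v \<and> length p \<le> 2"
proof -
  let ?N = "\<lambda>x. insert x {w. (x, w) \<in> parcs G}"
  have sub: "?N u \<subseteq> pverts G" "?N v \<subseteq> pverts G"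
    using assms(1,2) by (auto dest: wellformed')
  have "?N u \<inter> ?N v \<noteq> {}"
  proof
    assume disj: "?N u \<inter> ?N v = {}"
    have "card (?N u \<union> ?N v) = card (?N u) + card (?N v)"
      using sub disj finite_subset[OF _ pair_finite_verts] by (intro card_Un_disjoint) blast+
    moreover have "card (?N u \<union> ?N v) \<le> card (pverts G)"
      using sub by (intro card_mono pair_finite_verts) blast
    ultimately show False
      using deg by (simp only: card_closed_neighbourhood)
  qed
  then obtain w where w: "w = u \<or> (u, w) \<in> parcs G" "w = v \<or> (w, v) \<in> parcs G"
    by (auto intro: arc_sym)
  have "\<exists>p. awalk u p w \<and> length p \<le> 1"
    using w(1)
  proof
    assume "w = u"
    then show ?thesis
      using assms(1) by (intro exI[of _ "[]"]) (simp add: awalk_Nil_iff)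
  next
    assume "(u, w) \<in> parcs G"
    then show ?thesis
      by (intro exI[of _ "[(u, w)]"]) (auto simp: awalk_simps dest: wellformed')
  qed
  moreover have "\<exists>p. awalk w p v \<and> length p \<le> 1"
    using w(2)
  proof
    assume "w = v"
    then show ?thesis
      using assms(2) by (intro exI[of _ "[]"]) (simp add: awalk_Nil_iff)
  next
    assume "(w, v) \<in> parcs G"
    then show ?thesis
      by (intro exI[of _ "[(w, v)]"]) (auto simp: awalk_simps dest: wellformed')
  qed
  ultimately obtain p q where "awalk u p w" "awalk w q v" "length p \<le> 1" "length q \<le> 1"
    by blast
  then show ?thesis
    by (intro exI[of _ "p @ q"]) (auto intro: awalk_appendI)
qed

lemma graph_dist_le_length:
  assumes "awalk u p v"
  shows "graph_dist (with_proj G) u v \<le> ereal (real (length p))"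
proof -
  have "awalk_cost (\<lambda>_. 1) p = real (length p)"
    by (induct p) auto
  then show ?thesis
    using min_cost_le_walk_cost[OF assms, of "\<lambda>_. 1"] by (simp add: graph_dist_def)
qed

text \<open>
  The degree condition concerns only pairs that contain the hub \<open>y\<close>. Two other vertices may have
  disjoint closed neighbourhoods, so their distance is bounded by the detour through \<open>y\<close>.
\<close>

lemma diameter_le_4_if_hub:
  assumes y: "y \<in> pverts G"
    and deg: "\<And>u. u \<in> pverts G \<Longrightarrow>
      card (pverts G) \<le> Suc (out_degree (with_proj G) y + out_degree (with_proj G) u)"
  shows "diameter (with_proj G) \<le> 4"
  unfolding diameter_def
proof (intro SUP_least)
  fix u v
  assume uv: "u \<in> verts (with_proj G)" "v \<in> verts (with_proj G)"
  obtain p where p: "awalk u p y" "length p \<le> 2"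
    using short_walk_if_large_degree_sum[of u y] deg[of u] uv y by (auto simp: add.commute)
  obtain q where q: "awalk y q v" "length q \<le> 2"
    using short_walk_if_large_degree_sum[of y v] deg[of v] uv y by auto
  have "graph_dist (with_proj G) u v \<le> ereal (real (length (p @ q)))"
    using p(1) q(1) by (intro graph_dist_le_length awalk_appendI)
  also have "\<dots> \<le> 4"
    using p(2) q(2) by simp
  finally show "graph_dist (with_proj G) u v \<le> 4" .
qed

lemma out_degree_graph_complement:
  assumes v: "v \<in> pverts G"
  shows "out_degree (with_proj (graph_complement G)) v
    = card (pverts G) - Suc (out_degree (with_proj G) v)"
proof -
  interpret C: pair_graph "graph_complement G"
    by (intro pair_graph_complement pair_graph_axioms)
  let ?N = "insert v {w. (v, w) \<in> parcs G}"
  have "{w. (v, w) \<in> parcs (graph_complement G)} = pverts G - ?N"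
    using v by (auto simp: graph_complement_def)
  moreover have "?N \<subseteq> pverts G"
    using v by (auto dest: wellformed')
  ultimately show ?thesis
    by (simp only: C.out_degree_eq_card_neighbours card_closed_neighbourhood[symmetric]
        card_Diff_subset[OF finite_subset[OF _ pair_finite_verts]])
qed

end

lemma pair_graph_complete_graph: "pair_graph (complete_graph n)"
proof
  show "finite (parcs (complete_graph n))"
    by (rule finite_subset[of _ "{..<n} \<times> {..<n}"]) (auto simp: complete_graph_def)
qed (auto simp: complete_graph_def symmetric_def sym_def)

lemma degree_sequence_disjoint_complete_graphs:
  "degree_sequence (with_proj (disjoint_union (complete_graph m) (complete_graph n)))
    = replicate_mset m (m - 1) + replicate_mset n (n - 1)"
proof -
  let ?G = "disjoint_union (complete_graph m) (complete_graph n)"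
  interpret pair_graph ?G
    by (intro pair_graph_disjoint_union pair_graph_complete_graph)
  have l: "out_degree (with_proj ?G) (Inl i) = m - 1" if "i < m" for i
  proof -
    have "{w. (Inl i, w) \<in> parcs ?G} = Inl ` ({..<m} - {i})"
      using that by (auto simp: disjoint_union_def complete_graph_def)
    then show ?thesis
      using that by (simp add: out_degree_eq_card_neighbours card_image)
  qed
  have r: "out_degree (with_proj ?G) (Inr i) = n - 1" if "i < n" for i
  proof -
    have "{w. (Inr i, w) \<in> parcs ?G} = Inr ` ({..<n} - {i})"
      using that by (auto simp: disjoint_union_def complete_graph_def)
    then show ?thesis
      using that by (simp add: out_degree_eq_card_neighbours card_image)
  qed
  have "mset_set (pverts ?G) = mset_set (Inl ` {..<m}) + mset_set (Inr ` {..<n})"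
    by (simp add: disjoint_union_def complete_graph_def Plus_def) (subst mset_set_Union; auto)
  also have "\<dots> = image_mset Inl (mset_set {..<m}) + image_mset Inr (mset_set {..<n})"
    by (simp add: image_mset_mset_set)
  finally have "degree_sequence (with_proj ?G)
      = image_mset (\<lambda>i. out_degree (with_proj ?G) (Inl i)) (mset_set {..<m})
        + image_mset (\<lambda>i. out_degree (with_proj ?G) (Inr i)) (mset_set {..<n})"
    by (simp add: degree_sequence_def multiset.map_comp comp_def)
  also have "image_mset (\<lambda>i. out_degree (with_proj ?G) (Inl i)) (mset_set {..<m})
      = image_mset (\<lambda>i. m - 1) (mset_set {..<m})"
    by (rule image_mset_cong) (simp add: l)
  also have "image_mset (\<lambda>i. out_degree (with_proj ?G) (Inr i)) (mset_set {..<n})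
      = image_mset (\<lambda>i. n - 1) (mset_set {..<n})"
    by (rule image_mset_cong) (simp add: r)
  finally show ?thesis
    by (simp add: image_mset_const_eq)
qed

theorem proposition11:
  fixes m n :: nat and G :: "'a pair_pre_digraph"
  assumes "0 < m" and "0 < n"
    and "G \<in> co_clique_pair_class m n"
  shows "diameter (with_proj G) \<le> 4"
proof -
  obtain H where G: "G = graph_complement H" and H: "pair_graph H"
    and seq: "degree_sequence (with_proj H)
      = replicate_mset m (m - 1) + replicate_mset n (n - 1)"
    using assms(3) unfolding co_clique_pair_class_def clique_pair_class_def
      degree_sequence_disjoint_complete_graphs by blast
  interpret H: pair_graph H by (rule H)
  interpret G: pair_graph G
    unfolding G by (intro pair_graph_complement H)
  have V: "pverts G = pverts H"
    by (simp add: G graph_complement_def)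
  have card: "card (pverts H) = m + n"
    using arg_cong[OF seq, of size] by (simp add: degree_sequence_def)
  have degs: "out_degree (with_proj H) ` pverts H = {m - 1, n - 1}"
    using arg_cong[OF seq, of set_mset] assms(1,2) by (auto simp: degree_sequence_def)
  have compl: "out_degree (with_proj G) v = m + n - Suc (out_degree (with_proj H) v)"
    if "v \<in> pverts H" for v
    using H.out_degree_graph_complement[OF that] by (simp add: G card)
  \<comment> \<open>Complementation reverses the order of degrees, so a vertex of least degree in \<open>H\<close>
    has the largest degree, \<open>max m n\<close>, in \<open>G\<close>.\<close>
  have "min m n - 1 \<in> out_degree (with_proj H) ` pverts H"
    unfolding degs by (auto simp: min_def)
  then obtain y where y: "y \<in> pverts H" "out_degree (with_proj H) y = min m n - 1"
    by (metis imageE)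
  show ?thesis
  proof (rule G.diameter_le_4_if_hub)
    show "y \<in> pverts G"
      using y by (simp add: V)
    fix u
    assume "u \<in> pverts G"
    then have u: "u \<in> pverts H" and "out_degree (with_proj H) u \<in> {m - 1, n - 1}"
      using degs by (auto simp: V)
    then show "card (pverts G) \<le> Suc (out_degree (with_proj G) y + out_degree (with_proj G) u)"
      using compl[OF y(1)] compl[OF u] y(2) assms(1,2) by (auto simp: V card min_def)
  qed
qed

end
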